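(* Let $G$ be a finitely generated hyperbolic group, with a fixed finite generating set $S$. Then there exists a constant $c_{G,S}>0$ such that, for all integers $n,k\ge0$ and all finite non-empty sets $U\subseteq B_n$ and $V\subseteq B_k$, $$|UV|\ge c_{G,S}\,\frac{|U|\,|V|}{n+k+1}.$$ In particular, every hyperbolic group has large product growth.
   Context: $B_n$ denotes the ball of radius $n$ around the identity in the word metric on $G$ with respect to $S$, and $UV=\{uv:u\in U,v\in V\}$. A finitely generated group $G$ has large product growth if there exists a polynomial $P$ such that, for all $n,k$ and all finite subsets $U\subseteq B_n$ and $V\subseteq B_k$, $|UV|\ge\frac{|U|\,|V|}{P(n+k)}$. *)

theory Defs
  imports Complex_Main "HOL-Algebra.Coset" "HOL-Algebra.Generated_Groups"
    "HOL-Computational_Algebra.Polynomial"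
begin

definition finite_generating_set :: "('a, 'b) monoid_scheme \<Rightarrow> 'a set \<Rightarrow> bool" where
  "finite_generating_set G S \<longleftrightarrow>
     finite S \<and> S \<subseteq> carrier G \<and> generate G S = carrier G"

definition finitely_generated_group :: "('a, 'b) monoid_scheme \<Rightarrow> bool" where
  "finitely_generated_group G \<longleftrightarrow> group G \<and> (\<exists>S. finite_generating_set G S)"

text \<open>Generating sets need not be symmetric, so words use the letters of \<open>S\<close> and their inverses.\<close>

definition words :: "('a, 'b) monoid_scheme \<Rightarrow> 'a set \<Rightarrow> 'a list set" where
  "words G S = lists (S \<union> m_inv G ` S)"

definition word_value :: "('a, 'b) monoid_scheme \<Rightarrow> 'a list \<Rightarrow> 'a" where
  "word_value G w = foldr (\<lambda>x y. x \<otimes>\<^bsub>G\<^esub> y) w \<one>\<^bsub>G\<^esub>"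

text \<open>The length is meaningful only for elements of the subgroup generated by \<open>S\<close>; below,
  \<open>S\<close> always generates the group.\<close>

definition word_length :: "('a, 'b) monoid_scheme \<Rightarrow> 'a set \<Rightarrow> 'a \<Rightarrow> nat" where
  "word_length G S g = (LEAST n. \<exists>w\<in>words G S. length w = n \<and> word_value G w = g)"

definition word_dist :: "('a, 'b) monoid_scheme \<Rightarrow> 'a set \<Rightarrow> 'a \<Rightarrow> 'a \<Rightarrow> real" where
  "word_dist G S g h = real (word_length G S (inv\<^bsub>G\<^esub> g \<otimes>\<^bsub>G\<^esub> h))"

definition word_ball :: "('a, 'b) monoid_scheme \<Rightarrow> 'a set \<Rightarrow> nat \<Rightarrow> 'a set" where
  "word_ball G S n = {g \<in> carrier G. word_dist G S \<one>\<^bsub>G\<^esub> g \<le> real n}"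

definition gromov_product :: "('a \<Rightarrow> 'a \<Rightarrow> real) \<Rightarrow> 'a \<Rightarrow> 'a \<Rightarrow> 'a \<Rightarrow> real" where
  "gromov_product d e x y = (d e x + d e y - d x y) / 2"

text \<open>Gromov's definition, which makes sense for non-geodesic metric spaces and hence applies
  directly to a group with a word metric (the vertex set of the Cayley graph).\<close>

definition gromov_hyperbolic :: "'a set \<Rightarrow> ('a \<Rightarrow> 'a \<Rightarrow> real) \<Rightarrow> bool" where
  "gromov_hyperbolic M d \<longleftrightarrow>
     (\<exists>\<delta>\<ge>0. \<forall>e\<in>M. \<forall>x\<in>M. \<forall>y\<in>M. \<forall>z\<in>M.
        gromov_product d e x z \<ge> min (gromov_product d e x y) (gromov_product d e y z) - \<delta>)"

definition hyperbolic_group :: "('a, 'b) monoid_scheme \<Rightarrow> bool" where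
  "hyperbolic_group G \<longleftrightarrow>
     group G \<and> (\<exists>S. finite_generating_set G S \<and> gromov_hyperbolic (carrier G) (word_dist G S))"

text \<open>The property does not depend on the generating set, and it is required here for all of
  them. The polynomial is required to be positive at the natural numbers, since otherwise
  \<open>x / 0 = 0\<close> (or a negative value) would make the inequality void.\<close>

definition large_product_growth :: "('a, 'b) monoid_scheme \<Rightarrow> bool" where
  "large_product_growth G \<longleftrightarrow> finitely_generated_group G \<and>
     (\<forall>S. finite_generating_set G S \<longrightarrow>
       (\<exists>P :: real poly. (\<forall>m::nat. poly P (real m) > 0) \<and>
         (\<forall>n k U V. finite U \<and> U \<subseteq> word_ball G S n \<and> finite V \<and> V \<subseteq> word_ball G S k \<longrightarrow>
            real (card (U <#>\<^bsub>G\<^esub> V)) \<ge>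
              real (card U) * real (card V) / poly P (real (n + k)))))"

end

theory Submission imports Defs begin

text \<open>
  Suppose first that the word metric \<open>d\<close> is \<open>\<delta>\<close>-hyperbolic, and write \<open>(x|y)\<^sub>c\<close> for the Gromov product
  of \<open>x\<close> and \<open>y\<close> seen from \<open>c\<close>; it is roughly the distance from \<open>c\<close> to a geodesic from \<open>x\<close> to \<open>y\<close>.

  The idea is to write \<open>uv = (uc)(c\<inverse>v)\<close> for one well-chosen \<open>c\<close> that makes this product almost
  cancellation-free for a positive proportion of the pairs \<open>(u, v)\<close>. By left invariance, the
  cancellation is measured by \<open>(u\<inverse>|v)\<^sub>c\<close>. In a tree one would take for \<open>c\<close> a median of
  \<open>U\<inverse>\<close>: no branch at \<open>c\<close> contains more than half of \<open>U\<inverse>\<close>, so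
  whatever \<open>v\<close> is, the path from \<open>u\<inverse>\<close> to \<open>v\<close> runs through \<open>c\<close> for at least half of the \<open>u\<close>.
  In a hyperbolic group a minimiser \<open>c\<close> of the sum of the distances to \<open>U\<inverse>\<close>
  serves the same purpose: if more than three quarters of the \<open>u\<inverse>\<close> were seen from \<open>c\<close>
  in the direction of \<open>v\<close>, a step from \<open>c\<close> towards \<open>v\<close> would decrease the sum
  (\<open>median_sees_every_point_between\<close>).

  For such a pair, \<open>uc\<close> lies near a geodesic from \<open>\<one>\<close> to \<open>uv\<close>. Near a geodesic of length at most
  \<open>n + k\<close> there are only \<open>O(n + k + 1)\<close> group elements (\<open>card_near_geodesic\<close>), and \<open>uv\<close> and \<open>uc\<close>
  together determine \<open>u\<close> and \<open>v\<close>. So each element of \<open>UV\<close> comes from \<open>O(n + k + 1)\<close> of these pairs,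
  which number at least \<open>|U| |V| / 4\<close>; this is the bound.

  Passing to another generating set changes word lengths by at most a constant factor
  (\<open>word_ball_change_generators\<close>). It enlarges \<open>n\<close> and \<open>k\<close> by this factor and leaves the sets
  \<open>U\<close>, \<open>V\<close> and \<open>UV\<close> as they are, so only the constant in the bound changes.
\<close>

section \<open>Word metrics\<close>

locale word_metric = group G for G (structure) +
  fixes S :: "'a set"
  assumes generating: "finite_generating_set G S"
begin

abbreviation len :: "'a \<Rightarrow> nat" where "len \<equiv> word_length G S"

abbreviation d :: "'a \<Rightarrow> 'a \<Rightarrow> real" where "d \<equiv> word_dist G S"

lemma letters_closed: "S \<union> m_inv G ` S \<subseteq> carrier G"
  using generating by (auto simp: finite_generating_set_def)

lemma word_value_Nil [simp]: "word_value G [] = \<one>"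
  and word_value_Cons [simp]: "word_value G (x # w) = x \<otimes> word_value G w"
  by (simp_all add: word_value_def)

lemma word_value_closed: "w \<in> lists (carrier G) \<Longrightarrow> word_value G w \<in> carrier G"
  by (induction w) auto

lemma words_subset: "words G S \<subseteq> lists (carrier G)"
  unfolding words_def using letters_closed by (rule lists_mono)

lemma word_value_in_carrier: "w \<in> words G S \<Longrightarrow> word_value G w \<in> carrier G"
  using words_subset word_value_closed by blast

lemma word_value_append:
  assumes "v \<in> lists (carrier G)" "w \<in> lists (carrier G)"
  shows "word_value G (v @ w) = word_value G v \<otimes> word_value G w"
  using assms(1) by (induction v) (auto simp: m_assoc word_value_closed assms(2))

lemma word_value_rev_inv:
  assumes "w \<in> lists (carrier G)"
  shows "word_value G (rev (map (m_inv G) w)) = inv (word_value G w)"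
  using assms
proof (induction w)
  case (Cons x w)
  have "rev (map (m_inv G) w) \<in> lists (carrier G)"
    using Cons by auto
  then show ?case
    using Cons by (simp add: word_value_append inv_mult_group word_value_closed)
qed simp

lemma words_append: "v \<in> words G S \<Longrightarrow> w \<in> words G S \<Longrightarrow> v @ w \<in> words G S"
  by (simp add: words_def)

lemma words_rev_inv:
  assumes "w \<in> words G S"
  shows "rev (map (m_inv G) w) \<in> words G S"
proof -
  have "inv x \<in> S \<union> m_inv G ` S" if "x \<in> S \<union> m_inv G ` S" for x
    using that letters_closed by auto
  then show ?thesis
    using assms unfolding words_def in_lists_conv_set by auto
qed

lemma ex_word:
  assumes "g \<in> carrier G"
  shows "\<exists>w\<in>words G S. word_value G w = g"
proof -
  have "g \<in> generate G S"
    using assms generating by (simp add: finite_generating_set_def)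
  then show ?thesis
  proof (induction rule: generate.induct)
    case one
    show ?case by (rule bexI[of _ "[]"]) (auto simp: words_def)
  next
    case (incl h)
    then show ?case
      using letters_closed by (intro bexI[of _ "[h]"]) (auto simp: words_def)
  next
    case (inv h)
    then show ?case
      using letters_closed by (intro bexI[of _ "[inv h]"]) (auto simp: words_def)
  next
    case (eng g h)
    then obtain v w where "v \<in> words G S" "word_value G v = g"
      "w \<in> words G S" "word_value G w = h" by blast
    moreover from this have "word_value G (v @ w) = g \<otimes> h"
      using words_subset word_value_append[of v w] by blast
    ultimately show ?case
      using words_append by blast
  qed
qed

lemma len_word_value_le: "w \<in> words G S \<Longrightarrow> len (word_value G w) \<le> length w"
  unfolding word_length_def by (rule Least_le) blast

lemma obtain_geodesic_word:
  assumes "g \<in> carrier G"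
  obtains w where "w \<in> words G S" "word_value G w = g" "length w = len g"
proof -
  have "\<exists>n. \<exists>w\<in>words G S. length w = n \<and> word_value G w = g"
    using ex_word[OF assms] by blast
  from LeastI_ex[OF this] show thesis
    using that unfolding word_length_def by blast
qed

lemma len_one [simp]: "len \<one> = 0"
  using len_word_value_le[of "[]"] by (simp add: words_def)

lemma len_mult_le:
  assumes "g \<in> carrier G" "h \<in> carrier G"
  shows "len (g \<otimes> h) \<le> len g + len h"
proof -
  obtain v where v: "v \<in> words G S" "word_value G v = g" "length v = len g"
    using obtain_geodesic_word[OF assms(1)] .
  obtain w where w: "w \<in> words G S" "word_value G w = h" "length w = len h"
    using obtain_geodesic_word[OF assms(2)] .
  have "word_value G (v @ w) = g \<otimes> h"
    using v w words_subset word_value_append[of v w] by blast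
  then show ?thesis
    using len_word_value_le[OF words_append[OF v(1) w(1)]] v w by simp
qed

lemma len_inv_le:
  assumes "g \<in> carrier G"
  shows "len (inv g) \<le> len g"
proof -
  obtain w where w: "w \<in> words G S" "word_value G w = g" "length w = len g"
    using obtain_geodesic_word[OF assms] .
  have "word_value G (rev (map (m_inv G) w)) = inv g"
    using w words_subset word_value_rev_inv by blast
  then show ?thesis
    using len_word_value_le[OF words_rev_inv[OF w(1)]] w by simp
qed

lemma len_inv [simp]: "g \<in> carrier G \<Longrightarrow> len (inv g) = len g"
  using len_inv_le[of g] len_inv_le[of "inv g"] by simp

lemma dist_nonneg [simp]: "0 \<le> d x y"
  by (simp add: word_dist_def)

lemma dist_one: "g \<in> carrier G \<Longrightarrow> d \<one> g = real (len g)"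
  by (simp add: word_dist_def)

lemma dist_commute:
  assumes "x \<in> carrier G" "y \<in> carrier G"
  shows "d x y = d y x"
proof -
  have "inv x \<otimes> y = inv (inv y \<otimes> x)"
    using assms by (simp add: inv_mult_group)
  then show ?thesis
    using assms by (simp add: word_dist_def)
qed

lemma cancel_inv_left:
  assumes "g \<in> carrier G" "h \<in> carrier G"
  shows "inv g \<otimes> (g \<otimes> h) = h" and "g \<otimes> (inv g \<otimes> h) = h"
  using assms by (simp_all add: m_assoc[symmetric])

lemma dist_translate:
  assumes "g \<in> carrier G" "x \<in> carrier G" "y \<in> carrier G"
  shows "d (g \<otimes> x) (g \<otimes> y) = d x y"
proof -
  have "inv (g \<otimes> x) \<otimes> (g \<otimes> y) = inv x \<otimes> y"
    using assms by (simp add: inv_mult_group m_assoc cancel_inv_left)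
  then show ?thesis
    by (simp add: word_dist_def)
qed

lemma dist_triangle:
  assumes "x \<in> carrier G" "y \<in> carrier G" "z \<in> carrier G"
  shows "d x z \<le> d x y + d y z"
proof -
  have "inv x \<otimes> z = (inv x \<otimes> y) \<otimes> (inv y \<otimes> z)"
    using assms by (simp add: m_assoc cancel_inv_left)
  then have "len (inv x \<otimes> z) \<le> len (inv x \<otimes> y) + len (inv y \<otimes> z)"
    using assms len_mult_le[of "inv x \<otimes> y" "inv y \<otimes> z"] by simp
  then show ?thesis
    by (simp add: word_dist_def)
qed

lemma gromov_product_le_dist:
  assumes "e \<in> carrier G" "x \<in> carrier G" "y \<in> carrier G"
  shows "gromov_product d e x y \<le> d e y"
  using dist_triangle[of e y x] dist_commute[of x y] assms
  by (simp add: gromov_product_def)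

lemma word_ball_iff: "g \<in> word_ball G S n \<longleftrightarrow> g \<in> carrier G \<and> len g \<le> n"
  by (auto simp: word_ball_def dist_one)

lemma finite_word_ball: "finite (word_ball G S n)"
proof (rule finite_subset)
  let ?W = "{w. set w \<subseteq> S \<union> m_inv G ` S \<and> length w \<le> n}"
  show "word_ball G S n \<subseteq> word_value G ` ?W"
  proof
    fix g assume "g \<in> word_ball G S n"
    then have "g \<in> carrier G" "len g \<le> n"
      by (auto simp: word_ball_iff)
    moreover from this obtain w where "w \<in> words G S" "word_value G w = g" "length w = len g"
      using obtain_geodesic_word by blast
    ultimately show "g \<in> word_value G ` ?W"
      by (intro rev_image_eqI[of w]) (auto simp: words_def)
  qed
  show "finite (word_value G ` ?W)"
    using generating
    by (intro finite_imageI finite_lists_length_le) (auto simp: finite_generating_set_def)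
qed

text \<open>Word metrics are discretely geodesic: cutting a shortest word for \<open>x\<inverse>y\<close> after \<open>m\<close> letters
  gives a point between \<open>x\<close> and \<open>y\<close> at distance exactly \<open>m\<close> from \<open>x\<close>.\<close>

lemma ex_geodesic_point:
  assumes "x \<in> carrier G" "y \<in> carrier G" "real m \<le> d x y"
  shows "\<exists>z\<in>carrier G. d x z = real m \<and> d z y = d x y - real m"
proof -
  have "inv x \<otimes> y \<in> carrier G" using assms by simp
  then obtain w where w: "w \<in> words G S" "word_value G w = inv x \<otimes> y" "length w = len (inv x \<otimes> y)"
    using obtain_geodesic_word by blast
  define a b where "a = word_value G (take m w)" and "b = word_value G (drop m w)"
  have tw: "take m w \<in> words G S" and dw: "drop m w \<in> words G S"
    using w(1) unfolding words_def in_lists_conv_set by (auto dest: in_set_takeD in_set_dropD)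
  have ab: "a \<in> carrier G" "b \<in> carrier G"
    using tw dw by (auto simp: a_def b_def word_value_in_carrier)
  have "word_value G (take m w @ drop m w) = a \<otimes> b"
    unfolding a_def b_def using tw dw words_subset by (intro word_value_append) auto
  then have prod: "a \<otimes> b = inv x \<otimes> y"
    using w(2) by simp
  have m: "m \<le> length w"
    using assms(3) w(3) by (simp add: word_dist_def)
  have la: "len a \<le> m" "len b \<le> length w - m"
    using len_word_value_le[OF tw] len_word_value_le[OF dw] m by (simp_all add: a_def b_def)
  have dxz: "d x (x \<otimes> a) = len a"
    using assms ab by (simp add: word_dist_def cancel_inv_left)
  have "y = x \<otimes> a \<otimes> b"
    using assms ab prod by (simp add: m_assoc cancel_inv_left)
  then have dzy: "d (x \<otimes> a) y = len b"
    using assms(1) ab cancel_inv_left(1)[of "x \<otimes> a" b] by (simp add: word_dist_def)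
  have "d x y = length w"
    using w(3) by (simp add: word_dist_def)
  moreover have "d x y \<le> len a + len b"
    using dist_triangle[of x "x \<otimes> a" y] assms ab dxz dzy by simp
  ultimately have "len a = m" "len b = length w - m"
    using la m by linarith+
  then show ?thesis
    using dxz dzy m \<open>d x y = length w\<close> assms(1) ab(1)
    by (intro bexI[of _ "x \<otimes> a"]) auto
qed

lemma card_translate_le:
  assumes "p \<in> carrier G" "A \<subseteq> carrier G" "\<And>q. q \<in> A \<Longrightarrow> d p q \<le> real m"
  shows "card A \<le> card (word_ball G S m)"
proof (rule card_inj_on_le)
  show "inj_on (\<lambda>q. inv p \<otimes> q) A"
    using assms by (intro inj_onI) (auto simp: subset_iff)
  show "(\<lambda>q. inv p \<otimes> q) ` A \<subseteq> word_ball G S m"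
    using assms by (auto simp: word_ball_iff word_dist_def)
qed (rule finite_word_ball)

end

lemma (in group) word_ball_change_generators:
  assumes S: "finite_generating_set G S" and T: "finite_generating_set G T"
  shows "\<exists>C::nat. \<forall>n. word_ball G S n \<subseteq> word_ball G T (C * n)"
proof -
  interpret S: word_metric G S by unfold_locales (rule S)
  interpret T: word_metric G T by unfold_locales (rule T)
  define A where "A = S \<union> m_inv G ` S"
  define C where "C = (\<Sum>a\<in>A. T.len a)"
  have "finite A"
    using S by (simp add: A_def finite_generating_set_def)
  then have C: "T.len a \<le> C" if "a \<in> A" for a
    using that unfolding C_def by (intro member_le_sum) auto
  have bound: "T.len (word_value G w) \<le> C * length w" if "w \<in> lists A" for w
    using that
  proof (induction w)
    case (Cons a w)
    have "a \<in> carrier G" "word_value G w \<in> carrier G"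
      using Cons.hyps S.letters_closed S.word_value_in_carrier by (auto simp: A_def words_def)
    then have "T.len (word_value G (a # w)) \<le> T.len a + T.len (word_value G w)"
      by (simp add: T.len_mult_le)
    then show ?case
      using C[OF Cons.hyps(1)] Cons.IH by simp
  qed simp
  have "g \<in> word_ball G T (C * n)" if "g \<in> word_ball G S n" for g n
  proof -
    have g: "g \<in> carrier G" "S.len g \<le> n"
      using that by (auto simp: S.word_ball_iff)
    then obtain w where w: "w \<in> words G S" "word_value G w = g" "length w = S.len g"
      using S.obtain_geodesic_word by blast
    then have "T.len g \<le> C * S.len g"
      using bound[of w] by (simp add: words_def A_def)
    also have "\<dots> \<le> C * n"
      using g(2) by simp
    finally show ?thesis
      using g(1) by (simp add: T.word_ball_iff)
  qed
  then show ?thesis by blast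
qed

section \<open>Medians and neighbourhoods of geodesics in hyperbolic groups\<close>

locale hyperbolic_word_metric = word_metric +
  fixes \<delta> :: real
  assumes delta_nonneg: "0 \<le> \<delta>"
    and four_point: "\<lbrakk>e \<in> carrier G; x \<in> carrier G; y \<in> carrier G; z \<in> carrier G\<rbrakk> \<Longrightarrow>
      min (gromov_product d e x y) (gromov_product d e y z) - \<delta> \<le> gromov_product d e x z"
begin

text \<open>A point at distance \<open>m\<close> from \<open>c\<close> on a geodesic to \<open>y\<close> is nearer, by almost \<open>m\<close>, to all the points
  whose geodesics from \<open>c\<close> follow the one to \<open>y\<close> for length \<open>m\<close>.\<close>

lemma dist_after_step_le:
  assumes mem: "c \<in> carrier G" "y \<in> carrier G" "z \<in> carrier G" "x \<in> carrier G"
    and z: "d c z = m" "d z y = d c y - m"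
    and x: "m \<le> gromov_product d c x y"
  shows "d x z \<le> d c x - m + 2 * \<delta>"
proof -
  have "gromov_product d c y z = m"
    using z dist_commute[OF mem(2,3)] by (simp add: gromov_product_def)
  then have "m - \<delta> \<le> gromov_product d c x z"
    using four_point[OF mem(1,4,2,3)] x by simp
  then show ?thesis
    using z(1) by (simp add: gromov_product_def field_simps)
qed

text \<open>The median \<open>c\<close> is a point of least total distance to \<open>X\<close>; it exists because word lengths are
  natural numbers. If more than three quarters of \<open>X\<close> shared with \<open>y\<close> the first \<open>m\<close> steps from \<open>c\<close>, then
  walking these \<open>m\<close> steps would change the total distance by at most
  \<open>3/4 |X| (2\<delta> - m) + 1/4 |X| m\<close>, which is negative as soon as \<open>m > 3\<delta>\<close>.\<close>

lemma median_sees_every_point_between: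
  assumes X: "finite X" "X \<subseteq> carrier G" and m: "3 * \<delta> < real m"
  shows "\<exists>c\<in>carrier G. \<forall>y\<in>carrier G.
    card X \<le> 4 * card {x \<in> X. gromov_product d c x y \<le> real m}"
proof -
  define f where "f c = (\<Sum>x\<in>X. len (inv c \<otimes> x))" for c
  have f: "real (f c) = (\<Sum>x\<in>X. d c x)" for c
    by (simp add: f_def word_dist_def)
  obtain c where c: "c \<in> carrier G" "\<And>z. z \<in> carrier G \<Longrightarrow> f c \<le> f z"
    using ex_has_least_nat[of "\<lambda>g. g \<in> carrier G" \<one> f] by auto
  have "card X \<le> 4 * card {x \<in> X. gromov_product d c x y \<le> real m}" if y: "y \<in> carrier G" for y
  proof (rule ccontr)
    define N where "N = {x \<in> X. gromov_product d c x y \<le> real m}"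
    define F where "F = X - N"
    assume "\<not> ?thesis"
    then have less: "4 * card N < card X"
      by (simp add: N_def)
    have N: "N \<subseteq> X" "finite N" "finite F" "F \<subseteq> X"
      using X by (auto simp: N_def F_def)
    have cardX: "card X = card N + card F"
      using N X unfolding F_def by (simp add: card_Diff_subset card_mono)
    then have "F \<noteq> {}"
      using less by auto
    then obtain x0 where "x0 \<in> X" "real m < gromov_product d c x0 y"
      by (fastforce simp: F_def N_def)
    then have "real m \<le> d c y"
      using gromov_product_le_dist[of c x0 y] c(1) y X by auto
    then obtain z where z: "z \<in> carrier G" "d c z = real m" "d z y = d c y - real m"
      using ex_geodesic_point c(1) y by blast
    have far: "d z x \<le> d c x + (2 * \<delta> - real m)" if "x \<in> F" for x
      using dist_after_step_le[OF c(1) y z(1) _ z(2,3), of x] dist_commute[OF z(1), of x] that X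
      by (auto simp: F_def N_def)
    have near: "d z x \<le> d c x + real m" if "x \<in> N" for x
      using dist_triangle[of z c x] dist_commute[of z c] z c(1) that N X by auto
    have split: "(\<Sum>x\<in>X. d b x) = (\<Sum>x\<in>N. d b x) + (\<Sum>x\<in>F. d b x)" for b
      using sum.subset_diff[OF N(1) X(1), of "d b"] by (simp add: F_def)
    have "real (f z) \<le> (\<Sum>x\<in>N. d c x + real m) + (\<Sum>x\<in>F. d c x + (2 * \<delta> - real m))"
      unfolding f split using far near by (intro add_mono sum_mono)
    also have "\<dots> = real (f c) + (real (card N) * real m + real (card F) * (2 * \<delta> - real m))"
      unfolding f split by (simp add: sum.distrib)
    also have "\<dots> < real (f c)"
    proof -
      have F3: "3 * real (card N) + 1 \<le> real (card F)"
        using less cardX by linarith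
      have "real (card F) * (2 * \<delta> - real m) \<le> (3 * real (card N) + 1) * (2 * \<delta> - real m)"
        using F3 m delta_nonneg by (intro mult_right_mono_neg) auto
      also have "\<dots> = - real (card N) * real m + 2 * real (card N) * (3 * \<delta> - real m) + (2 * \<delta> - real m)"
        by (simp add: algebra_simps)
      also have "\<dots> < - real (card N) * real m"
      proof -
        have "2 * real (card N) * (3 * \<delta> - real m) \<le> 0"
          using m by (intro mult_nonneg_nonpos) auto
        then show ?thesis
          using m delta_nonneg by linarith
      qed
      finally show ?thesis by simp
    qed
    finally show False
      using c(2)[OF z(1)] by simp
  qed
  then show ?thesis
    using c(1) by blast
qed

text \<open>Two points near a geodesic from \<open>\<one>\<close> to \<open>g\<close> and at the same distance from \<open>\<one>\<close> are close to each
  other, so there are boundedly many of them at each distance from \<open>\<one>\<close>.\<close>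

lemma card_near_geodesic:
  assumes g: "g \<in> carrier G" and r: "real r \<ge> 2 * (real m + \<delta>)"
  defines "P \<equiv> {p \<in> carrier G. gromov_product d p \<one> g \<le> real m}"
  shows "finite P" and "card P \<le> (len g + 2 * m + 1) * card (word_ball G S r)"
proof -
  define Q where "Q i = {p \<in> P. len p = i}" for i
  have P_len: "len p \<le> len g + 2 * m" if "p \<in> P" for p
  proof -
    have "p \<in> carrier G" "d p \<one> + d p g - d \<one> g \<le> 2 * real m"
      using that by (auto simp: P_def gromov_product_def)
    then have "real (len p) \<le> real (len g) + 2 * real m"
      using dist_nonneg[of p g] dist_commute[of p \<one>] g
      by (simp add: dist_one del: dist_nonneg)
    then show ?thesis by linarith
  qed
  then have "P \<subseteq> word_ball G S (len g + 2 * m)"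
    by (auto simp: word_ball_iff P_def)
  then show "finite P"
    by (rule finite_subset) (rule finite_word_ball)
  have Q: "card (Q i) \<le> card (word_ball G S r)" for i
  proof (cases "Q i = {}")
    case False
    then obtain p where p: "p \<in> Q i" by blast
    have near: "real i - real m \<le> gromov_product d \<one> q g" if "q \<in> Q i" for q
      using that dist_commute[of q \<one>] g
      by (auto simp: Q_def P_def gromov_product_def dist_one field_simps)
    have "d p q \<le> real r" if q: "q \<in> Q i" for q
    proof -
      have mem: "p \<in> carrier G" "q \<in> carrier G" "len p = i" "len q = i"
        using p q by (auto simp: Q_def P_def)
      have "gromov_product d \<one> g q = gromov_product d \<one> q g"
        using dist_commute[OF g mem(2)] by (simp add: gromov_product_def)
      then have "real i - real m - \<delta> \<le> gromov_product d \<one> p q"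
        using four_point[OF one_closed mem(1) g mem(2)] near[OF p] near[OF q] by linarith
      then show ?thesis
        using mem r by (simp add: gromov_product_def dist_one field_simps)
    qed
    then show ?thesis
      using p by (intro card_translate_le[of p]) (auto simp: Q_def P_def)
  qed simp
  have "P \<subseteq> (\<Union>i\<le>len g + 2 * m. Q i)"
    using P_len by (auto simp: Q_def)
  then have "card P \<le> card (\<Union>i\<le>len g + 2 * m. Q i)"
    using \<open>finite P\<close> by (intro card_mono) (auto simp: Q_def)
  also have "\<dots> \<le> (\<Sum>i\<le>len g + 2 * m. card (Q i))"
    by (rule card_UN_le) simp
  also have "\<dots> \<le> (\<Sum>i\<le>len g + 2 * m. card (word_ball G S r))"
    using Q by (rule sum_mono)
  finally show "card P \<le> (len g + 2 * m + 1) * card (word_ball G S r)"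
    by simp
qed

section \<open>Product sets\<close>

text \<open>With \<open>c\<close> a median of \<open>U\<inverse>\<close>, the map \<open>(u, v) \<mapsto> (uv, uc)\<close> is injective and sends the pairs
  for which \<open>(u\<inverse>|v)\<^sub>c\<close> is small to pairs of some \<open>g \<in> UV\<close> and a point near a geodesic from \<open>\<one>\<close> to
  \<open>g\<close>.\<close>

lemma card_set_mult_bound:
  assumes m: "3 * \<delta> < real m" and r: "real r \<ge> 2 * (real m + \<delta>)"
    and U: "finite U" "U \<subseteq> word_ball G S n" and V: "finite V" "V \<subseteq> word_ball G S k"
  shows "card U * card V \<le> 4 * (card (U <#> V) * ((n + k + 2 * m + 1) * card (word_ball G S r)))"
proof -
  have Uc: "U \<subseteq> carrier G" and Vc: "V \<subseteq> carrier G"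
    using U V by (auto simp: word_ball_iff)
  define X where "X = m_inv G ` U"
  have X: "finite X" "X \<subseteq> carrier G"
    using U(1) Uc by (auto simp: X_def)
  have injinv: "inj_on (m_inv G) U"
    using Uc by (meson inj_onI inv_inj inj_on_subset)
  then have cardX: "card X = card U"
    by (simp add: X_def card_image)
  obtain c where c: "c \<in> carrier G" "\<And>y. y \<in> carrier G \<Longrightarrow>
      card X \<le> 4 * card {x \<in> X. gromov_product d c x y \<le> real m}"
    using median_sees_every_point_between[OF X m] by blast
  define Good where "Good v = {u \<in> U. gromov_product d c (inv u) v \<le> real m}" for v
  define near where "near g = {p \<in> carrier G. gromov_product d p \<one> g \<le> real m}" for g
  have Good: "card U \<le> 4 * card (Good v)" if "v \<in> V" for v
  proof -
    have "{x \<in> X. gromov_product d c x v \<le> real m} = m_inv G ` Good v"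
      by (auto simp: X_def Good_def)
    moreover have "card (m_inv G ` Good v) = card (Good v)"
      using injinv by (intro card_image) (auto simp: Good_def elim: inj_on_subset)
    ultimately show ?thesis
      using c(2)[of v] that Vc cardX by auto
  qed
  have finUV: "finite (U <#> V)"
    using U(1) V(1) by (auto simp: set_mult_def)
  have UVlen: "g \<in> carrier G \<and> len g \<le> n + k" if g: "g \<in> U <#> V" for g
  proof -
    obtain u v where "u \<in> U" "v \<in> V" "g = u \<otimes> v"
      using g unfolding set_mult_def by blast
    moreover from this have "u \<in> carrier G" "len u \<le> n" "v \<in> carrier G" "len v \<le> k"
      using U(2) V(2) by (auto simp: word_ball_iff)
    ultimately show ?thesis
      using len_mult_le[of u v] by auto
  qed
  have near_fin: "finite (near g)"
    and near_card: "card (near g) \<le> (n + k + 2 * m + 1) * card (word_ball G S r)"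
    if "g \<in> U <#> V" for g
  proof -
    show "finite (near g)"
      unfolding near_def using UVlen[OF that] r by (intro card_near_geodesic) auto
    have "card (near g) \<le> (len g + 2 * m + 1) * card (word_ball G S r)"
      unfolding near_def using UVlen[OF that] r by (intro card_near_geodesic) auto
    also have "\<dots> \<le> (n + k + 2 * m + 1) * card (word_ball G S r)"
      using UVlen[OF that] by (intro mult_right_mono) auto
    finally show "card (near g) \<le> (n + k + 2 * m + 1) * card (word_ball G S r)" .
  qed
  define \<phi> where "\<phi> = (\<lambda>(v, u). (u \<otimes> v, u \<otimes> c))"
  have inj: "inj_on \<phi> (Sigma V Good)"
  proof (rule inj_onI, clarsimp simp: \<phi>_def)
    fix v u v' u'
    assume "v \<in> V" "u \<in> Good v" "v' \<in> V" "u' \<in> Good v'"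
      and eq: "u \<otimes> v = u' \<otimes> v'" "u \<otimes> c = u' \<otimes> c"
    then have mem: "u \<in> carrier G" "u' \<in> carrier G" "v \<in> carrier G" "v' \<in> carrier G"
      using Uc Vc by (auto simp: Good_def)
    with eq(2) c(1) have "u = u'" by simp
    with eq(1) mem show "v = v' \<and> u = u'" by simp
  qed
  have sub: "\<phi> ` Sigma V Good \<subseteq> Sigma (U <#> V) near"
  proof (clarsimp simp: \<phi>_def)
    fix v u assume v: "v \<in> V" and u: "u \<in> Good v"
    have mem: "u \<in> U" "u \<in> carrier G" "v \<in> carrier G"
      using u v Uc Vc by (auto simp: Good_def)
    \<comment> \<open>left translation by \<open>u\<close> takes \<open>c\<close>, \<open>u\<inverse>\<close>, \<open>v\<close> to \<open>uc\<close>, \<open>\<one>\<close>, \<open>uv\<close>\<close>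
    have "gromov_product d (u \<otimes> c) \<one> (u \<otimes> v) = gromov_product d c (inv u) v"
      using dist_translate[of u c "inv u"] dist_translate[of u c v] dist_translate[of u "inv u" v]
        mem c(1) by (simp add: gromov_product_def)
    then show "u \<otimes> v \<in> U <#> V \<and> u \<otimes> c \<in> near (u \<otimes> v)"
      using u v mem c(1) by (auto simp: near_def Good_def set_mult_def)
  qed
  have finGood: "finite (Good v)" for v
    using U(1) by (simp add: Good_def)
  have "card U * card V = (\<Sum>v\<in>V. card U)"
    by simp
  also have "\<dots> \<le> (\<Sum>v\<in>V. 4 * card (Good v))"
    by (rule sum_mono) (rule Good)
  also have "\<dots> = 4 * card (Sigma V Good)"
    using V(1) finGood by (simp add: sum_distrib_left)
  also have "card (Sigma V Good) \<le> card (Sigma (U <#> V) near)"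
    using inj sub finUV near_fin by (intro card_inj_on_le[of \<phi>]) auto
  also have "card (Sigma (U <#> V) near) = (\<Sum>g\<in>U <#> V. card (near g))"
    using finUV near_fin by simp
  also have "\<dots> \<le> card (U <#> V) * ((n + k + 2 * m + 1) * card (word_ball G S r))"
    using sum_mono[OF near_card, of "U <#> V" "\<lambda>g. g"] by simp
  finally show ?thesis
    by simp
qed

lemma product_set_bound:
  "\<exists>a::nat. \<forall>n k U V. finite U \<and> U \<subseteq> word_ball G S n \<and> finite V \<and> V \<subseteq> word_ball G S k \<longrightarrow>
     card U * card V \<le> a * (n + k + 1) * card (U <#> V)"
proof -
  obtain m :: nat where m: "3 * \<delta> < real m"
    using reals_Archimedean2 by blast
  obtain r :: nat where r: "2 * (real m + \<delta>) \<le> real r"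
    using real_arch_simple by blast
  define b where "b = card (word_ball G S r)"
  have "card U * card V \<le> 4 * (2 * m + 1) * b * (n + k + 1) * card (U <#> V)"
    if "finite U" "U \<subseteq> word_ball G S n" "finite V" "V \<subseteq> word_ball G S k" for n k U V
  proof -
    have "n + k + 2 * m + 1 \<le> (2 * m + 1) * (n + k + 1)"
      by (simp add: algebra_simps)
    then have "4 * (card (U <#> V) * ((n + k + 2 * m + 1) * b))
        \<le> 4 * (card (U <#> V) * (((2 * m + 1) * (n + k + 1)) * b))"
      by (intro mult_left_mono mult_right_mono) auto
    also have "\<dots> = 4 * (2 * m + 1) * b * (n + k + 1) * card (U <#> V)"
      by (simp only: mult_ac)
    finally show ?thesis
      using card_set_mult_bound[OF m r that] unfolding b_def by (rule order_trans[rotated])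
  qed
  then show ?thesis by blast
qed

end

lemma hyperbolic_group_product_set_bound:
  assumes hyp: "hyperbolic_group G" and S: "finite_generating_set G S"
  shows "\<exists>c::real. c > 0 \<and> (\<forall>n k U V.
    finite U \<and> U \<subseteq> word_ball G S n \<and> finite V \<and> V \<subseteq> word_ball G S k \<longrightarrow>
    c * (real (card U) * real (card V) / real (n + k + 1)) \<le> real (card (U <#>\<^bsub>G\<^esub> V)))"
proof -
  obtain T where G: "group G" and T: "finite_generating_set G T"
    and "gromov_hyperbolic (carrier G) (word_dist G T)"
    using hyp by (auto simp: hyperbolic_group_def)
  then obtain \<delta> where \<delta>: "\<delta> \<ge> 0" and four: "\<forall>e\<in>carrier G. \<forall>x\<in>carrier G. \<forall>y\<in>carrier G. \<forall>z\<in>carrier G.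
      gromov_product (word_dist G T) e x z \<ge>
      min (gromov_product (word_dist G T) e x y) (gromov_product (word_dist G T) e y z) - \<delta>"
    by (auto simp: gromov_hyperbolic_def)
  interpret group G by fact
  interpret T: hyperbolic_word_metric G T \<delta>
    using T \<delta> four by unfold_locales auto
  obtain a :: nat where a: "\<And>n k U V.
      finite U \<and> U \<subseteq> word_ball G T n \<and> finite V \<and> V \<subseteq> word_ball G T k \<Longrightarrow>
      card U * card V \<le> a * (n + k + 1) * card (U <#>\<^bsub>G\<^esub> V)"
    using T.product_set_bound by blast
  obtain C :: nat where C: "\<And>n. word_ball G S n \<subseteq> word_ball G T (C * n)"
    using word_ball_change_generators[OF S T] by blast
  \<comment> \<open>successors, because \<open>C\<close> may be \<open>0\<close> (when \<open>G\<close> is trivial) and \<open>A\<close> becomes a denominator\<close>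
  define A where "A = Suc a * Suc C"
  have A: "0 < real A"
    by (simp add: A_def del: mult_Suc mult_Suc_right of_nat_Suc)
  have "1 / real A * (real (card U) * real (card V) / real (n + k + 1)) \<le> real (card (U <#>\<^bsub>G\<^esub> V))"
    if *: "finite U" "U \<subseteq> word_ball G S n" "finite V" "V \<subseteq> word_ball G S k" for n k U V
  proof -
    have "card U * card V \<le> a * (C * n + C * k + 1) * card (U <#>\<^bsub>G\<^esub> V)"
      using * C by (intro a) blast
    also have "\<dots> \<le> Suc a * (Suc C * (n + k + 1)) * card (U <#>\<^bsub>G\<^esub> V)"
      by (intro mult_mono) (auto simp: algebra_simps)
    finally have "real (card U * card V) \<le> real (Suc a * (Suc C * (n + k + 1)) * card (U <#>\<^bsub>G\<^esub> V))"
      by (rule of_nat_mono)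
    then have "real (card U) * real (card V) \<le> real (card (U <#>\<^bsub>G\<^esub> V)) * (real (n + k + 1) * real A)"
      unfolding A_def by (simp only: of_nat_mult mult_ac)
    moreover have "0 < real (n + k + 1) * real A"
      using A by (intro mult_pos_pos) simp_all
    ultimately have "real (card U) * real (card V) / (real (n + k + 1) * real A)
        \<le> real (card (U <#>\<^bsub>G\<^esub> V))"
      by (simp only: pos_divide_le_eq)
    then show ?thesis
      by (simp only: times_divide_times_eq mult_1 mult.commute[of "real A"])
  qed
  then show ?thesis
    using A by (intro exI[of _ "1 / real A"]) simp
qed

theorem theorem1p5:
  fixes G :: "('a, 'b) monoid_scheme"
  assumes "hyperbolic_group G"
  shows "(\<forall>S. finite_generating_set G S \<longrightarrow>
           (\<exists>c::real. c > 0 \<and>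
             (\<forall>(n::nat) (k::nat) U V.
                finite U \<and> U \<noteq> {} \<and> U \<subseteq> word_ball G S n \<and>
                finite V \<and> V \<noteq> {} \<and> V \<subseteq> word_ball G S k \<longrightarrow>
                real (card (U <#>\<^bsub>G\<^esub> V)) \<ge>
                  c * (real (card U) * real (card V) / real (n + k + 1)))))
         \<and> large_product_growth G"
proof
  have bound: "\<exists>c::real. c > 0 \<and> (\<forall>n k U V.
      finite U \<and> U \<subseteq> word_ball G S n \<and> finite V \<and> V \<subseteq> word_ball G S k \<longrightarrow>
      c * (real (card U) * real (card V) / real (n + k + 1)) \<le> real (card (U <#>\<^bsub>G\<^esub> V)))"
    if "finite_generating_set G S" for S
    using hyperbolic_group_product_set_bound[OF assms that] .
  then show "\<forall>S. finite_generating_set G S \<longrightarrow>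
           (\<exists>c::real. c > 0 \<and>
             (\<forall>(n::nat) (k::nat) U V.
                finite U \<and> U \<noteq> {} \<and> U \<subseteq> word_ball G S n \<and>
                finite V \<and> V \<noteq> {} \<and> V \<subseteq> word_ball G S k \<longrightarrow>
                real (card (U <#>\<^bsub>G\<^esub> V)) \<ge>
                  c * (real (card U) * real (card V) / real (n + k + 1))))"
    by meson
  show "large_product_growth G"
    unfolding large_product_growth_def
  proof (intro conjI allI impI)
    show "finitely_generated_group G"
      using assms by (auto simp: hyperbolic_group_def finitely_generated_group_def)
    fix S assume "finite_generating_set G S"
    then obtain c :: real where c: "c > 0" and le: "\<And>n k U V.
        finite U \<and> U \<subseteq> word_ball G S n \<and> finite V \<and> V \<subseteq> word_ball G S k \<Longrightarrow>
        c * (real (card U) * real (card V) / real (n + k + 1)) \<le> real (card (U <#>\<^bsub>G\<^esub> V))"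
      using bound by meson
    define P where "P = [:1 / c, 1 / c:]"
    have P: "poly P (real m) = real (m + 1) / c" for m
      using c by (simp add: P_def field_simps)
    have "real (card U) * real (card V) / poly P (real (n + k)) \<le> real (card (U <#>\<^bsub>G\<^esub> V))"
      if "finite U \<and> U \<subseteq> word_ball G S n \<and> finite V \<and> V \<subseteq> word_ball G S k" for n k U V
      using le[OF that] unfolding P by (simp add: mult_ac)
    moreover have "\<forall>m::nat. poly P (real m) > 0"
      using c by (simp add: P)
    ultimately show "\<exists>P :: real poly. (\<forall>m::nat. poly P (real m) > 0) \<and>
         (\<forall>n k U V. finite U \<and> U \<subseteq> word_ball G S n \<and> finite V \<and> V \<subseteq> word_ball G S k \<longrightarrow>
            real (card (U <#>\<^bsub>G\<^esub> V)) \<ge>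
              real (card U) * real (card V) / poly P (real (n + k)))"
      by blast
  qed
qed

end
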